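(* Let $\mathbf{w}_1,\dots,\mathbf{w}_n\in\mathbb{R}^n$ be linearly independent unit vectors and let $C=\mathfrak{c}(\mathbf{w}_1,\dots,\mathbf{w}_n)$. Then $C$ can be decomposed into a finite family of cones; that is, there exist finitely many cones $C_1,\dots,C_N\subseteq\mathbb{R}^n$ and signs $s_1,\dots,s_N\in\{\pm1\}$ such that $$[C]\equiv\sum_{m=1}^N s_m[C_m]\quad\text{modulo indicator functions of lower-dimensional cones},$$ where each $C_m$ is either (I) a cone of affine dimension less than $n$, or (II) a full-dimensional cone $\mathfrak{c}(\mathbf{v}_1,\dots,\mathbf{v}_n)$ generated by some vectors $\mathbf{v}_1,\dots,\mathbf{v}_n$ satisfying the following properties, where $M_n$ denotes its associated matrix (with $(i,j)$ entry $-|\mathbf{v}_i\cdot\mathbf{v}_j|$ for $i\neq j$ and diagonal entries $1$), so that $M_n$ is positive definite: (a) $\|\mathbf{v}_i\|=1$ for $i=1,\dots,n$; (b) $\mathbf{v}_n=\mathbf{w}_n$; (c) $\langle\mathbf{v}_1,\dots,\mathbf{v}_{n-1}\rangle=\langle\mathbf{w}_1,\dots,\mathbf{w}_{n-1}\rangle$; (d) $\mathbf{v}_i\cdot\mathbf{v}_n=0$ for $i=1,\dots,n-2$; (e) there are signs $\epsilon_1,\dots,\epsilon_n\in\{\pm1\}$ such that $\mathbf{x}^TM_n\,\mathbf{x}=\left\|\begin{bmatrix}\epsilon_1\mathbf{v}_1,\dots,\epsilon_n\mathbf{v}_n\end{bmatrix}\mathbf{x}\right\|^2$ for every $\mathb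f{x}\in\mathbb{R}^n$.
   Context: $\mathfrak{c}(\mathbf{w}_1,\dots,\mathbf{w}_d)$ denotes the cone generated by the vectors $\mathbf{w}_1,\dots,\mathbf{w}_d$ (all nonnegative linear combinations), and $\langle\mathbf{w}_1,\dots,\mathbf{w}_d\rangle$ their linear span. Cones are polyhedral. $[C]$ denotes the indicator function of the cone $C$. The relation "$\equiv$ modulo indicator functions of lower-dimensional cones" means that the difference of the two sides is a finite linear combination of indicator functions of polyhedral cones in $\mathbb{R}^n$ of affine dimension less than $n$. In (e), $\begin{bmatrix}\epsilon_1\mathbf{v}_1,\dots,\epsilon_n\mathbf{v}_n\end{bmatrix}$ is the $n\times n$ matrix with columns $\epsilon_i\mathbf{v}_i$. *)

theory Defs
  imports "HOL-Analysis.Analysis"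
begin

text \<open>
  \<open>\<real>\<^sup>n\<close> is \<open>real ^ 'n\<close> for an arbitrary finite linearly ordered index type \<open>'n\<close>, whose elements in
  increasing order play the role of \<open>1, \<dots>, n\<close>; thus \<open>n = CARD('n) \<ge> 1\<close>. Every \<open>n \<ge> 1\<close> arises this
  way (the numeral types of \<open>HOL-Library.Numeral_Type\<close> are instances). The index \<open>n\<close> is
  \<open>last_index\<close>, and the indices \<open>i\<close> in \<open>1, \<dots>, n - 2\<close> are those with \<open>i < j < last_index\<close> for some \<open>j\<close>.
\<close>

abbreviation last_index :: "'n::{finite,linorder}" where
  "last_index \<equiv> Max UNIV"

abbreviation generated_cone :: "('i::finite \<Rightarrow> 'a::real_vector) \<Rightarrow> 'a set" where
  "generated_cone v \<equiv> convex_cone hull (range v)"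

lemma generated_cone_eq:
  fixes v :: "'i::finite \<Rightarrow> 'a::real_vector"
  shows "generated_cone v = {\<Sum>i\<in>UNIV. c i *\<^sub>R v i | c. \<forall>i. 0 \<le> c i}" (is "_ = ?K")
proof
  have "convex_cone ?K"
    unfolding convex_cone_iff
  proof (intro conjI ballI allI impI)
    show "0 \<in> ?K" by (rule CollectI, rule exI[of _ "\<lambda>_. 0"]) simp
  next
    fix x y assume "x \<in> ?K" "y \<in> ?K"
    then obtain c d where "x = (\<Sum>i\<in>UNIV. c i *\<^sub>R v i)" "\<forall>i. 0 \<le> c i"
      "y = (\<Sum>i\<in>UNIV. d i *\<^sub>R v i)" "\<forall>i. 0 \<le> d i" by blast
    then show "x + y \<in> ?K"
      by (intro CollectI exI[of _ "\<lambda>i. c i + d i"]) (simp add: scaleR_add_left sum.distrib)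
  next
    fix x and a :: real assume "x \<in> ?K" "0 \<le> a"
    then obtain c where "x = (\<Sum>i\<in>UNIV. c i *\<^sub>R v i)" "\<forall>i. 0 \<le> c i" by blast
    with \<open>0 \<le> a\<close> show "a *\<^sub>R x \<in> ?K"
      by (intro CollectI exI[of _ "\<lambda>i. a * c i"]) (simp add: scaleR_sum_right)
  qed
  moreover have "range v \<subseteq> ?K"
  proof (rule image_subsetI)
    fix j
    have "v j = (\<Sum>i\<in>UNIV. (if i = j then 1 else 0) *\<^sub>R v i)"
      by (simp add: if_distrib[of "\<lambda>r. r *\<^sub>R _"] cong: if_cong)
    then show "v j \<in> ?K"
      by (intro CollectI exI[of _ "\<lambda>i. if i = j then 1 else 0"]) auto
  qed
  ultimately show "generated_cone v \<subseteq> ?K"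
    by (intro hull_minimal)
next
  have "(\<Sum>i\<in>I. c i *\<^sub>R v i) \<in> generated_cone v" if "\<forall>i. 0 \<le> c i" "finite I" for c I
    using that(2)
  proof induction
    case (insert j F)
    have "c j *\<^sub>R v j \<in> generated_cone v"
      using that(1) by (intro convex_cone_hull_mul hull_inc) auto
    with insert show ?case by (simp add: convex_cone_hull_add)
  qed (simp add: convex_cone_hull_contains_0)
  then show "?K \<subseteq> generated_cone v" by auto
qed

definition polyhedral_cone :: "'a::euclidean_space set \<Rightarrow> bool" where
  "polyhedral_cone C \<longleftrightarrow> polyhedron C \<and> convex_cone C"

definition equiv_mod_lower_dim :: "('a::euclidean_space \<Rightarrow> real) \<Rightarrow> ('a \<Rightarrow> real) \<Rightarrow> bool" where
  "equiv_mod_lower_dim f g \<longleftrightarrow>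
     (\<exists>(\<D> :: 'a set set) (a :: 'a set \<Rightarrow> real).
        finite \<D> \<and> (\<forall>D\<in>\<D>. polyhedral_cone D \<and> aff_dim D < int DIM('a)) \<and>
        (\<forall>x. f x - g x = (\<Sum>D\<in>\<D>. a D * indicator D x)))"

definition assoc_matrix :: "('n::finite \<Rightarrow> real ^ 'n) \<Rightarrow> real ^ 'n ^ 'n" where
  "assoc_matrix v = (\<chi> i j. if i = j then 1 else - \<bar>v i \<bullet> v j\<bar>)"

definition positive_definite :: "real ^ 'n ^ 'n \<Rightarrow> bool" where
  "positive_definite M \<longleftrightarrow> transpose M = M \<and> (\<forall>x. x \<noteq> 0 \<longrightarrow> 0 < x \<bullet> (M *v x))"

definition matrix_of_columns :: "('n::finite \<Rightarrow> real ^ 'm) \<Rightarrow> real ^ 'n ^ 'm" where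
  "matrix_of_columns v = (\<chi> i j. v j $ i)"

end

theory Submission
  imports Defs
begin

text \<open>
  Every family arising below consists of linearly independent vectors. If \<open>p = a v\<^sub>i + b v\<^sub>j\<close> with
  \<open>a, b > 0\<close>, then up to a cone of lower dimension \<open>\<cc>(v)\<close> is the disjoint union of the two cones
  obtained by replacing \<open>v\<^sub>i\<close>, respectively \<open>v\<^sub>j\<close>, by \<open>p\<close>; read backwards, this also expresses
  \<open>\<cc>(v)\<close> as a difference of two cones when \<open>p = b v\<^sub>j - a v\<^sub>i\<close>. If at least two \<open>v\<^sub>i\<close>, \<open>v\<^sub>j\<close> with
  \<open>i, j < m\<close> are not orthogonal to \<open>v\<^sub>m\<close>, one of these moves, with \<open>p\<close> orthogonal to \<open>v\<^sub>m\<close>,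
  decreases the number of such vectors in both new cones. Once at most one is left, it is permuted into
  position \<open>m - 1\<close>. Doing this for \<open>m = n, n - 1, \<dots>\<close> never changes \<open>v\<^sub>n\<close> or the span of the first
  \<open>n - 1\<close> vectors and preserves the orthogonality reached earlier, so it ends with cones whose Gram
  matrix is tridiagonal. For these, signs making all off-diagonal entries nonpositive can be chosen
  successively along the path \<open>1, \<dots>, n\<close>, and the associated matrix is the Gram matrix of the signed
  vectors.
\<close>

section \<open>Calculus of equivalence modulo lower-dimensional cones\<close>

lemma equiv_mod_lower_dim_refl: "equiv_mod_lower_dim f f"
  unfolding equiv_mod_lower_dim_def by (intro exI[of _ "{}"]) auto

lemma equiv_mod_lower_dim_add:
  fixes f g f' g' :: "'a::euclidean_space \<Rightarrow> real"
  assumes "equiv_mod_lower_dim f g" "equiv_mod_lower_dim f' g'"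
  shows "equiv_mod_lower_dim (\<lambda>x. f x + f' x) (\<lambda>x. g x + g' x)"
proof -
  obtain D a where D: "finite D" "\<forall>d\<in>D. polyhedral_cone d \<and> aff_dim d < int DIM('a)"
    "\<And>x. f x - g x = (\<Sum>d\<in>D. a d * indicator d x)"
    using assms(1) unfolding equiv_mod_lower_dim_def by metis
  obtain E b where E: "finite E" "\<forall>d\<in>E. polyhedral_cone d \<and> aff_dim d < int DIM('a)"
    "\<And>x. f' x - g' x = (\<Sum>d\<in>E. b d * indicator d x)"
    using assms(2) unfolding equiv_mod_lower_dim_def by metis
  define c where "c d = (if d \<in> D then a d else 0) + (if d \<in> E then b d else 0)" for d
  have "f x + f' x - (g x + g' x) = (\<Sum>d\<in>D \<union> E. c d * indicator d x)" for x
  proof -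
    have "(\<Sum>d\<in>D \<union> E. c d * indicator d x) =
      (\<Sum>d\<in>D \<union> E. (if d \<in> D then a d else 0) * indicator d x) +
      (\<Sum>d\<in>D \<union> E. (if d \<in> E then b d else 0) * indicator d x)"
      by (simp add: c_def distrib_right sum.distrib)
    also have "(\<Sum>d\<in>D \<union> E. (if d \<in> D then a d else 0) * indicator d x) =
        (\<Sum>d\<in>D. a d * indicator d x)"
      using D E by (intro sum.mono_neutral_cong_right) auto
    also have "(\<Sum>d\<in>D \<union> E. (if d \<in> E then b d else 0) * indicator d x) =
        (\<Sum>d\<in>E. b d * indicator d x)"
      using D E by (intro sum.mono_neutral_cong_right) auto
    finally show ?thesis
      using D(3)[of x] E(3)[of x] by simp
  qed
  with D E show ?thesis
    unfolding equiv_mod_lower_dim_def by (intro exI[of _ "D \<union> E"] exI[of _ c]) auto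
qed

lemma equiv_mod_lower_dim_scale:
  fixes f g :: "'a::euclidean_space \<Rightarrow> real"
  assumes "equiv_mod_lower_dim f g"
  shows "equiv_mod_lower_dim (\<lambda>x. r * f x) (\<lambda>x. r * g x)"
proof -
  obtain D a where D: "finite D" "\<forall>d\<in>D. polyhedral_cone d \<and> aff_dim d < int DIM('a)"
    "\<And>x. f x - g x = (\<Sum>d\<in>D. a d * indicator d x)"
    using assms unfolding equiv_mod_lower_dim_def by metis
  have "r * f x - r * g x = (\<Sum>d\<in>D. (r * a d) * indicator d x)" for x
    by (simp add: D(3) sum_distrib_left mult.assoc flip: right_diff_distrib)
  with D show ?thesis
    unfolding equiv_mod_lower_dim_def by (intro exI[of _ D] exI[of _ "\<lambda>d. r * a d"]) auto
qed

text \<open>Adding the two relations compares \<open>f + g\<close> with \<open>g + h\<close>. Their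
  difference is \<open>f - h\<close>, and only the difference enters the relation.\<close>

lemma equiv_mod_lower_dim_trans:
  assumes "equiv_mod_lower_dim f g" "equiv_mod_lower_dim g h"
  shows "equiv_mod_lower_dim f h"
  using equiv_mod_lower_dim_add[OF assms]
  unfolding equiv_mod_lower_dim_def by simp

section \<open>Dimension of generated cones and coordinates in a basis\<close>

lemma polyhedral_generated_cone:
  fixes v :: "'i::finite \<Rightarrow> 'a::euclidean_space"
  shows "polyhedral_cone (generated_cone v)"
  by (simp add: polyhedral_cone_def polyhedron_convex_cone_hull convex_cone_convex_cone_hull)

lemma aff_dim_generated_cone:
  fixes v :: "'i::finite \<Rightarrow> 'a::euclidean_space"
  shows "aff_dim (generated_cone v) = int (dim (range v))"
proof -
  have "span (generated_cone v) = span (range v)"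
  proof (rule antisym)
    have "generated_cone v \<subseteq> span (range v)"
      unfolding generated_cone_eq by clarify (intro span_sum span_scale span_base rangeI)
    then show "span (generated_cone v) \<subseteq> span (range v)"
      by (metis span_mono span_span)
  qed (intro span_mono hull_subset)
  then show ?thesis
    by (metis aff_dim_zero convex_cone_hull_contains_0 dim_span hull_inc)
qed

text \<open>\<open>independent\<close> speaks of sets; injectivity transfers it to indexed families,
  so that coordinates with respect to a family can be compared.\<close>

lemma independent_sum_eq:
  fixes v :: "'i::finite \<Rightarrow> 'a::real_vector"
  assumes "inj v" "independent (range v)"
    and eq: "(\<Sum>i\<in>UNIV. c i *\<^sub>R v i) = (\<Sum>i\<in>UNIV. d i *\<^sub>R v i)"
  shows "c = d"
proof
  fix i
  have "(\<Sum>x\<in>range v. (c (inv v x) - d (inv v x)) *\<^sub>R x) = (\<Sum>i\<in>UNIV. (c i - d i) *\<^sub>R v i)"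
    using assms(1) by (simp add: sum.reindex)
  also have "\<dots> = 0"
    using eq by (simp add: scaleR_left_diff_distrib sum_subtractf)
  finally have "c (inv v (v i)) - d (inv v (v i)) = 0"
    by (intro independentD[OF assms(2)]) auto
  then show "c i = d i"
    using assms(1) by simp
qed

section \<open>Exchanging a generator and subdividing a cone\<close>

lemma span_fun_upd:
  fixes v :: "'i \<Rightarrow> 'a::real_vector"
  assumes "i \<in> A" "j \<in> A" "i \<noteq> j" "a \<noteq> 0" and p: "p = a *\<^sub>R v i + b *\<^sub>R v j"
  shows "span (v(i := p) ` A) = span (v ` A)"
proof (rule antisym)
  have "p \<in> span (v ` A)"
    unfolding p using assms by (intro span_add span_scale span_base) auto
  then show "span (v(i := p) ` A) \<subseteq> span (v ` A)"
    by (intro span_minimal) (auto intro: span_base)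
next
  have vk: "v k \<in> span (v(i := p) ` A)" if "k \<in> A" "k \<noteq> i" for k
    using that by (intro span_base image_eqI[of _ _ k]) auto
  have "v i = (1 / a) *\<^sub>R (p - b *\<^sub>R v j)"
    using assms by (simp add: p)
  also have "\<dots> \<in> span (v(i := p) ` A)"
    using assms vk[of j] by (intro span_scale span_diff) (auto intro!: span_base image_eqI[of _ _ i])
  finally show "span (v ` A) \<subseteq> span (v(i := p) ` A)"
    using vk by (intro span_minimal subspace_span) (metis image_subsetI)
qed

text \<open>A spanning family of \<open>n\<close> vectors is a basis by counting. Hence the
  condition \<open>span (range v) = UNIV\<close> is enough to carry linear independence through all
  moves.\<close>

lemma spanning_family_independent:
  fixes v :: "'n::finite \<Rightarrow> real ^ 'n"
  assumes "span (range v) = UNIV"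
  shows "inj v \<and> independent (range v)"
proof -
  have "CARD('n) \<le> card (range v)"
    using dim_le_card[of "UNIV :: (real ^ 'n) set" "range v"] assms by simp
  then have card: "card (range v) = CARD('n)"
    using card_image_le[of UNIV v] by simp
  then have "inj v"
    by (intro eq_card_imp_inj_on) auto
  moreover have "independent (range v)"
    using assms card by (intro card_le_dim_spanning[of _ UNIV]) auto
  ultimately show ?thesis ..
qed

text \<open>In coordinates \<open>c\<close> with respect to \<open>v\<close>, the hyperplane
  \<open>b * c i = a * c j\<close> cuts the cone into the two new ones. Their common face is counted
  twice, and it is the cone of lower dimension that has to be subtracted.\<close>

lemma indicator_subdivision:
  fixes v :: "'n::finite \<Rightarrow> real ^ 'n"
  assumes spanning: "span (range v) = UNIV" and "i \<noteq> j" "0 < a" "0 < b"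
    and p: "p = a *\<^sub>R v i + b *\<^sub>R v j"
  shows "equiv_mod_lower_dim (indicator (generated_cone v))
    (\<lambda>x. indicator (generated_cone (v(i := p))) x + indicator (generated_cone (v(j := p))) x)"
proof -
  \<comment> \<open>The common face. Its missing generator is replaced by 0, which keeps the index
    type.\<close>
  define u where "u = v(i := p, j := 0)"
  have ind: "inj v" "independent (range v)"
    using spanning_family_independent[OF spanning] by auto
  \<comment> \<open>Here \<open>e\<close> turns coordinates in \<open>v'\<close> into coordinates in
    \<open>v\<close>. By uniqueness of the latter, membership asks for a nonnegative preimage of
    \<open>c\<close> under \<open>e\<close>.\<close>
  have mem: "(\<Sum>k\<in>UNIV. c k *\<^sub>R v k) \<in> generated_cone v' \<longleftrightarrow>
      (\<exists>d. (\<forall>k. 0 \<le> d k) \<and> c = e d)"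
    if "\<And>d. (\<Sum>k\<in>UNIV. d k *\<^sub>R v' k) = (\<Sum>k\<in>UNIV. e d k *\<^sub>R v k)" for c v' e
    unfolding generated_cone_eq that using independent_sum_eq[OF ind] by blast
  have split: "(\<Sum>k\<in>UNIV. f k) = f i + f j + (\<Sum>k\<in>-{i,j}. f k)" for f :: "'n \<Rightarrow> real ^ 'n"
    using \<open>i \<noteq> j\<close> sum.subset_diff[of "{i,j}" UNIV f] by (simp add: Compl_eq_Diff_UNIV add.commute)
  have A: "(\<Sum>k\<in>UNIV. d k *\<^sub>R v k) = (\<Sum>k\<in>UNIV. d k *\<^sub>R v k)" for d :: "'n \<Rightarrow> real" ..
  have B: "(\<Sum>k\<in>UNIV. d k *\<^sub>R (v(i := p)) k) =
      (\<Sum>k\<in>UNIV. (d(i := a * d i, j := d j + b * d i)) k *\<^sub>R v k)" for d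
    using \<open>i \<noteq> j\<close> unfolding split by (simp add: p algebra_simps cong: sum.cong_simp)
  have C: "(\<Sum>k\<in>UNIV. d k *\<^sub>R (v(j := p)) k) =
      (\<Sum>k\<in>UNIV. (d(j := b * d j, i := d i + a * d j)) k *\<^sub>R v k)" for d
    using \<open>i \<noteq> j\<close> unfolding split by (simp add: p algebra_simps cong: sum.cong_simp)
  have D: "(\<Sum>k\<in>UNIV. d k *\<^sub>R u k) =
      (\<Sum>k\<in>UNIV. (d(i := a * d i, j := b * d i)) k *\<^sub>R v k)" for d
    using \<open>i \<noteq> j\<close> unfolding split by (simp add: u_def p algebra_simps cong: sum.cong_simp)
  have main: "indicator (generated_cone v) x -
      (indicator (generated_cone (v(i := p))) x + indicator (generated_cone (v(j := p))) x) =
      - (indicator (generated_cone u) x :: real)" for x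
  proof -
    have "x \<in> span (range v)" using spanning by simp
    then obtain c0 where "x = (\<Sum>y\<in>range v. c0 y *\<^sub>R y)"
      unfolding span_finite[OF finite_imageI, OF finite] by blast
    then obtain c where x: "x = (\<Sum>k\<in>UNIV. c k *\<^sub>R v k)"
      using that[of "c0 \<circ> v"] ind(1) by (simp add: sum.reindex)
    let ?R = "\<forall>k. k \<noteq> i \<longrightarrow> k \<noteq> j \<longrightarrow> 0 \<le> c k"
    have 1: "x \<in> generated_cone v \<longleftrightarrow> 0 \<le> c i \<and> 0 \<le> c j \<and> ?R"
      unfolding x mem[OF A] by auto
    \<comment> \<open>The witness solves \<open>c i = a * d i\<close> and
      \<open>c j = d j + b * d i\<close> for \<open>d\<close>. Its \<open>j\<close>-th coordinate is
      nonnegative exactly on one side of the cutting hyperplane.\<close>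
    have 2: "x \<in> generated_cone (v(i := p)) \<longleftrightarrow> 0 \<le> c i \<and> b * c i \<le> a * c j \<and> ?R"
      unfolding x mem[OF B] 
    proof
      assume R: "0 \<le> c i \<and> b * c i \<le> a * c j \<and> ?R"
      have "c = (\<lambda>d. d(i := a * d i, j := d j + b * d i)) (c(i := c i / a, j := c j - b * c i / a))"
        using \<open>0 < a\<close> \<open>i \<noteq> j\<close> by (auto simp: fun_eq_iff)
      with R show "\<exists>d. (\<forall>k. 0 \<le> d k) \<and> c = d(i := a * d i, j := d j + b * d i)"
        using \<open>0 < a\<close> \<open>i \<noteq> j\<close>
        by (intro exI[of _ "c(i := c i / a, j := c j - b * c i / a)"])
          (auto simp: field_simps)
    qed (use \<open>i \<noteq> j\<close> \<open>0 < a\<close> \<open>0 < b\<close> in \<open>auto simp: distrib_left\<close>)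
    have 3: "x \<in> generated_cone (v(j := p)) \<longleftrightarrow> 0 \<le> c j \<and> a * c j \<le> b * c i \<and> ?R"
      unfolding x mem[OF C]
    proof
      assume R: "0 \<le> c j \<and> a * c j \<le> b * c i \<and> ?R"
      have "c = (\<lambda>d. d(j := b * d j, i := d i + a * d j)) (c(j := c j / b, i := c i - a * c j / b))"
        using \<open>0 < b\<close> \<open>i \<noteq> j\<close> by (auto simp: fun_eq_iff)
      with R show "\<exists>d. (\<forall>k. 0 \<le> d k) \<and> c = d(j := b * d j, i := d i + a * d j)"
        using \<open>0 < b\<close> \<open>i \<noteq> j\<close>
        by (intro exI[of _ "c(j := c j / b, i := c i - a * c j / b)"])
          (auto simp: field_simps)
    qed (use \<open>i \<noteq> j\<close> \<open>0 < a\<close> \<open>0 < b\<close> in \<open>auto simp: distrib_left\<close>)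
    have 4: "x \<in> generated_cone u \<longleftrightarrow> 0 \<le> c i \<and> b * c i = a * c j \<and> ?R"
      unfolding x mem[OF D]
    proof
      assume R: "0 \<le> c i \<and> b * c i = a * c j \<and> ?R"
      \<comment> \<open>The coefficient at \<open>j\<close> multiplies the zero vector, so any
        nonnegative value would do; 0 is chosen.\<close>
      have "c = (\<lambda>d. d(i := a * d i, j := b * d i)) (c(i := c i / a, j := 0))"
        using R \<open>0 < a\<close> \<open>i \<noteq> j\<close> by (auto simp: fun_eq_iff)
      with R show "\<exists>d. (\<forall>k. 0 \<le> d k) \<and> c = d(i := a * d i, j := b * d i)"
        using \<open>0 < a\<close> \<open>i \<noteq> j\<close>
        by (intro exI[of _ "c(i := c i / a, j := 0)"]) (auto simp: field_simps)
    qed (use \<open>i \<noteq> j\<close> \<open>0 < a\<close> \<open>0 < b\<close> in \<open>auto simp: distrib_left\<close>)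
    \<comment> \<open>With the next fact, this supplies the sign condition of \<open>1\<close> that
      \<open>2\<close> and \<open>3\<close> leave implicit.\<close>
    have 5: "0 \<le> c j" if "b * c i \<le> a * c j" "0 \<le> c i"
    proof -
      have "0 \<le> b * c i" using that \<open>0 < b\<close> by simp
      then have "0 \<le> a * c j" using that by linarith
      with \<open>0 < a\<close> show ?thesis by (simp add: zero_le_mult_iff)
    qed
    have 6: "0 \<le> c i" if "a * c j \<le> b * c i" "0 \<le> c j"
    proof -
      have "0 \<le> a * c j" using that \<open>0 < a\<close> by simp
      then have "0 \<le> b * c i" using that by linarith
      with \<open>0 < b\<close> show ?thesis by (simp add: zero_le_mult_iff)
    qed
    show ?thesis
    proof (cases ?R)
      case True
      then have R: "?R = True" by simp
      show ?thesis
        \<comment> \<open>Off the hyperplane a point of the cone lies in exactly one half; on it, in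
          both halves and in the face.\<close>
        unfolding indicator_def 1 2 3 4 R simp_thms
        using 5 6 by (cases "b * c i" "a * c j" rule: linorder_cases) auto
    next
      case False
      then show ?thesis
        unfolding indicator_def 1 2 3 4 by simp
    qed
  qed
  have "dim (range u) < CARD('n)"
  proof -
    have "range u \<subseteq> span (u ` (-{j}))"
      by (auto intro: span_base simp: u_def span_zero)
    then have "dim (range u) \<le> card (u ` (-{j}))"
      by (intro dim_le_card) auto
    also have "\<dots> \<le> card (-{j})"
      by (rule card_image_le) simp
    also have "\<dots> < CARD('n)"
      by (rule psubset_card_mono) auto
    finally show ?thesis .
  qed
  then show ?thesis
    unfolding equiv_mod_lower_dim_def main
    by (intro exI[of _ "{generated_cone u}"] exI[of _ "\<lambda>_. -1"])
      (simp add: polyhedral_generated_cone aff_dim_generated_cone)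
qed

section \<open>Signed decompositions into generated cones\<close>

definition decomposable :: "(('i::finite \<Rightarrow> 'a::euclidean_space) \<Rightarrow> bool) \<Rightarrow> ('a \<Rightarrow> real) \<Rightarrow> bool" where
  "decomposable P f \<longleftrightarrow> (\<exists>xs. (\<forall>(s, v)\<in>set xs. s \<in> {1, -1} \<and> P v) \<and>
     equiv_mod_lower_dim f (\<lambda>x. \<Sum>(s, v)\<leftarrow>xs. s * indicator (generated_cone v) x))"

lemma decomposable_indicator: "P v \<Longrightarrow> decomposable P (indicator (generated_cone v))"
  unfolding decomposable_def
  by (intro exI[of _ "[(1, v)]"]) (simp add: equiv_mod_lower_dim_refl)

lemma decomposable_equiv:
  "equiv_mod_lower_dim f g \<Longrightarrow> decomposable P g \<Longrightarrow> decomposable P f"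
  unfolding decomposable_def by (meson equiv_mod_lower_dim_trans)

lemma decomposable_add:
  assumes "decomposable P f" "decomposable P g"
  shows "decomposable P (\<lambda>x. f x + g x)"
proof -
  obtain xs where xs: "\<forall>(s, v)\<in>set xs. s \<in> {1, -1} \<and> P v"
     "equiv_mod_lower_dim f (\<lambda>x. \<Sum>(s, v)\<leftarrow>xs. s * indicator (generated_cone v) x)"
    using assms(1) unfolding decomposable_def by blast
  obtain ys where ys: "\<forall>(s, v)\<in>set ys. s \<in> {1, -1} \<and> P v"
     "equiv_mod_lower_dim g (\<lambda>x. \<Sum>(s, v)\<leftarrow>ys. s * indicator (generated_cone v) x)"
    using assms(2) unfolding decomposable_def by blast
  show ?thesis
    unfolding decomposable_def
    using xs ys equiv_mod_lower_dim_add[OF xs(2) ys(2)] by (intro exI[of _ "xs @ ys"]) auto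
qed

lemma decomposable_minus:
  assumes "decomposable P f"
  shows "decomposable P (\<lambda>x. - f x)"
proof -
  obtain xs where xs: "\<forall>(s, v)\<in>set xs. s \<in> {1, -1} \<and> P v"
     "equiv_mod_lower_dim f (\<lambda>x. \<Sum>(s, v)\<leftarrow>xs. s * indicator (generated_cone v) x)"
    using assms(1) unfolding decomposable_def by blast
  have "(\<Sum>(s, v)\<leftarrow>map (\<lambda>(s, v). (- s, v)) xs. s * indicator (generated_cone v) x) =
      - (\<Sum>(s, v)\<leftarrow>xs. s * indicator (generated_cone v) x)" for x
    by (induction xs) auto
  then show ?thesis
    unfolding decomposable_def
    using xs equiv_mod_lower_dim_scale[OF xs(2), of "-1"]
    by (intro exI[of _ "map (\<lambda>(s, v). (- s, v)) xs"]) auto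
qed

lemma decomposable_subdivision:
  fixes v :: "'n::finite \<Rightarrow> real ^ 'n"
  assumes "span (range v) = UNIV" "i \<noteq> j" "0 < a" "0 < b" "p = a *\<^sub>R v i + b *\<^sub>R v j"
    and "decomposable P (indicator (generated_cone (v(i := p))))"
    and "decomposable P (indicator (generated_cone (v(j := p))))"
  shows "decomposable P (indicator (generated_cone v))"
  using decomposable_equiv[OF indicator_subdivision[OF assms(1-5)] decomposable_add[OF assms(6,7)]] .

text \<open>The vector \<open>v j\<close> is a positive combination of \<open>v i\<close> and
  \<open>p\<close>. It therefore subdivides the larger cone of \<open>v(j := p)\<close> into the
  cone of \<open>v\<close> and that of \<open>v(j := p, i := v j)\<close>, and the cone of
  \<open>v\<close> is recovered as a difference.\<close>

lemma decomposable_extension: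
  fixes v :: "'n::finite \<Rightarrow> real ^ 'n"
  assumes span: "span (range v) = UNIV" and "i \<noteq> j" "0 < a" "0 < b"
    and p: "p = b *\<^sub>R v j - a *\<^sub>R v i"
    and dec: "decomposable P (indicator (generated_cone (v(j := p))))"
      "decomposable P (indicator (generated_cone (v(j := p, i := v j))))"
  shows "decomposable P (indicator (generated_cone v))"
proof -
  define u where "u = v(j := p)"
  have uij: "u i = v i" "u j = p" "u(i := v j) = v(j := p, i := v j)" "u(j := v j) = v"
    using \<open>i \<noteq> j\<close> by (auto simp: u_def)
  have "span (range u) = UNIV"
    unfolding u_def using span_fun_upd[of j UNIV i b p v "- a"] assms by simp
  moreover have "v j = (a / b) *\<^sub>R u i + (1 / b) *\<^sub>R u j"
    using \<open>0 < b\<close> by (simp add: uij p algebra_simps)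
  ultimately have *: "equiv_mod_lower_dim (indicator (generated_cone u))
    (\<lambda>x. indicator (generated_cone (u(i := v j))) x + indicator (generated_cone (u(j := v j))) x)"
    using \<open>i \<noteq> j\<close> \<open>0 < a\<close> \<open>0 < b\<close> by (intro indicator_subdivision) auto
  have "equiv_mod_lower_dim (indicator (generated_cone v))
     (\<lambda>x. indicator (generated_cone u) x + - indicator (generated_cone (u(i := v j))) x)"
    using equiv_mod_lower_dim_scale[OF *, of "-1"] unfolding uij equiv_mod_lower_dim_def
    by (simp add: algebra_simps)
  then show ?thesis
    using decomposable_add[OF dec(1) decomposable_minus[OF dec(2)]]
    unfolding uij u_def by (rule decomposable_equiv)
qed

section \<open>Reduction to tridiagonal Gram matrices\<close>

definition same_flag :: "('n::{finite,linorder} \<Rightarrow> 'a::real_vector) \<Rightarrow> ('n \<Rightarrow> 'a) \<Rightarrow> bool" where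
  "same_flag w v \<longleftrightarrow>
     v last_index = w last_index \<and> span (v ` {..<last_index}) = span (w ` {..<last_index})"

text \<open>The index \<open>k\<close> between \<open>i\<close> and \<open>j\<close> expresses that
  they are not adjacent. The condition is vacuous for \<open>m = last_index\<close> and is full
  tridiagonality for the least \<open>m\<close>.\<close>

definition tridiagonal_above :: "'n::linorder \<Rightarrow> ('n \<Rightarrow> 'a::real_inner) \<Rightarrow> bool" where
  "tridiagonal_above m v \<longleftrightarrow> (\<forall>i k j. i < k \<longrightarrow> k < j \<longrightarrow> m < j \<longrightarrow> v i \<bullet> v j = 0)"

lemma same_flag_span:
  fixes v w :: "'n::{finite,linorder} \<Rightarrow> 'a::real_vector"
  assumes "same_flag w v"
  shows "span (range v) = span (range w)"
proof -
  have "(UNIV :: 'n set) = insert last_index {..<last_index}"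
    using Max_ge[of "UNIV :: 'n set"] by (auto simp: order.strict_iff_order)
  then have range: "range u = insert (u last_index) (u ` {..<last_index})" for u :: "'n \<Rightarrow> 'a"
    by (metis image_insert)
  show ?thesis
    unfolding range using assms by (simp add: same_flag_def span_insert)
qed

lemma same_flag_fun_upd:
  assumes "same_flag w v" "i < last_index" "j < last_index" "i \<noteq> j" "a \<noteq> 0"
    and "p = a *\<^sub>R v i + b *\<^sub>R v j"
  shows "same_flag w (v(i := p))"
proof -
  have "last_index \<noteq> i" using assms(2) by (metis less_irrefl)
  then show ?thesis
    using assms span_fun_upd[of i "{..<last_index}" j a p v b]
    by (simp add: same_flag_def del: fun_upd_apply) (simp only: fun_upd_apply if_False)
qed

text \<open>Since \<open>m\<close> separates \<open>i\<close> and \<open>j\<close> from every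
  \<open>l > m\<close>, both \<open>v i\<close> and \<open>v j\<close> are orthogonal to
  \<open>v l\<close>, and so is any combination of them.\<close>

lemma tridiagonal_above_fun_upd:
  assumes "tridiagonal_above m v" "i < m" "j < m" "p = a *\<^sub>R v i + b *\<^sub>R v j"
  shows "tridiagonal_above m (v(i := p))"
  unfolding tridiagonal_above_def
proof (intro allI impI)
  fix i' k l assume l: "i' < k" "k < l" "m < l"
  with assms have "v i \<bullet> v l = 0" "v j \<bullet> v l = 0" "v i' \<bullet> v l = 0"
    unfolding tridiagonal_above_def by blast+
  with l assms show "(v(i := p)) i' \<bullet> (v(i := p)) l = 0"
    by (auto simp: inner_add_left)
qed

text \<open>Two nested inductions: the outer one on the number of indices below \<open>m\<close>,
  the inner one on how many of these carry a vector not orthogonal to \<open>v m\<close>.\<close>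

lemma tridiagonal_decomposition:
  fixes v w :: "'n \<Rightarrow> real ^ 'n::{finite,linorder}"
  assumes "span (range w) = UNIV" "same_flag w v" "tridiagonal_above m v"
  shows "decomposable (\<lambda>u. same_flag w u \<and> (\<forall>i k j. i < k \<longrightarrow> k < j \<longrightarrow> u i \<bullet> u j = 0))
    (indicator (generated_cone v))" (is "decomposable ?P _")
  using assms(2,3)
proof (induction "card {..<m}" arbitrary: m v rule: less_induct)
  case outer: less
  show ?case
    using outer.prems
  proof (induction "card {i\<in>{..<m}. v i \<bullet> v m \<noteq> 0}" arbitrary: v rule: less_induct)
    case inner: less
    let ?B = "\<lambda>v. {i\<in>{..<m}. v i \<bullet> v m \<noteq> 0}"
    have last: "i < last_index" if "i < m" for i :: 'n
      using that Max_ge[of UNIV m] by (simp del: Max_ge)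
    have spanning: "span (range v) = UNIV"
      using same_flag_span[OF inner.prems(1)] assms(1) by simp
    have IH: "decomposable ?P (indicator (generated_cone u))"
      if "same_flag w u" "tridiagonal_above m u" "?B u \<subset> ?B v" for u
      using that by (intro inner.hyps psubset_card_mono) auto
    show ?case
    proof (cases "\<exists>i\<in>?B v. \<exists>j\<in>?B v. i \<noteq> j")
      case True
      then obtain i j where ij: "i < m" "j < m" "i \<noteq> j" and h: "v i \<bullet> v m \<noteq> 0" "v j \<bullet> v m \<noteq> 0"
        by auto
      let ?a = "\<bar>v j \<bullet> v m\<bar>" and ?b = "\<bar>v i \<bullet> v m\<bar>"
      show ?thesis
      proof (cases "(v i \<bullet> v m) * (v j \<bullet> v m) < 0")
        case True
        \<comment> \<open>The inner products with \<open>v m\<close> have opposite signs, so a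
          positive combination is orthogonal to \<open>v m\<close>. Each half of the subdivision
          loses one index from \<open>?B v\<close>.\<close>
        define p where "p = ?a *\<^sub>R v i + ?b *\<^sub>R v j"
        have p': "p = ?b *\<^sub>R v j + ?a *\<^sub>R v i" by (simp add: p_def)
        have orth: "p \<bullet> v m = 0"
          using True by (auto simp: p_def inner_add_left mult_less_0_iff)
        show ?thesis
        proof (rule decomposable_subdivision[OF spanning ij(3) _ _ p_def])
          show "decomposable ?P (indicator (generated_cone (v(i := p))))"
            using same_flag_fun_upd[OF inner.prems(1) last[OF ij(1)] last[OF ij(2)] ij(3) _ p_def]
              tridiagonal_above_fun_upd[OF inner.prems(2) ij(1,2) p_def] ij h orth
            by (intro IH) (auto simp: psubset_eq)
          show "decomposable ?P (indicator (generated_cone (v(j := p))))"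
            using same_flag_fun_upd[OF inner.prems(1) last[OF ij(2)] last[OF ij(1)] _ _ p']
              tridiagonal_above_fun_upd[OF inner.prems(2) ij(2,1) p'] ij h orth
            by (intro IH) (auto simp: psubset_eq)
        qed (use h in auto)
      next
        case False
        \<comment> \<open>The signs agree, so the orthogonal combination is a difference and the
          cone is extended instead. In both resulting families position \<open>j\<close> holds
          \<open>p\<close> and leaves \<open>?B v\<close>; in the second, \<open>i\<close> receives
          \<open>v j\<close> and stays in it.\<close>
        define p where "p = ?b *\<^sub>R v j - ?a *\<^sub>R v i"
        define u where "u = v(j := p)"
        have p': "p = ?b *\<^sub>R v j + (- ?a) *\<^sub>R v i" by (simp add: p_def)
        have orth: "p \<bullet> v m = 0"
          using False h by (auto simp: p_def inner_diff_left mult_less_0_iff not_less abs_if)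
        have u: "same_flag w u" "tridiagonal_above m u"
          using same_flag_fun_upd[OF inner.prems(1) last[OF ij(2)] last[OF ij(1)] _ _ p']
            tridiagonal_above_fun_upd[OF inner.prems(2) ij(2,1) p'] ij h
          by (auto simp: u_def)
        \<comment> \<open>This presents the second family as one more exchange applied to
          \<open>u\<close>, so the preservation lemmas apply again.\<close>
        have vj: "v j = (?a / ?b) *\<^sub>R u i + (1 / ?b) *\<^sub>R u j"
          using h ij by (simp add: u_def p_def algebra_simps)
        show ?thesis
        proof (rule decomposable_extension[OF spanning ij(3) _ _ p_def])
          show "decomposable ?P (indicator (generated_cone (v(j := p))))"
            using u ij h orth by (intro IH) (auto simp: psubset_eq u_def)
          have "same_flag w (u(i := v j))" "tridiagonal_above m (u(i := v j))"
            using same_flag_fun_upd[OF u(1) last[OF ij(1)] last[OF ij(2)] ij(3) _ vj]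
              tridiagonal_above_fun_upd[OF u(2) ij(1,2) vj] h by auto
          then show "decomposable ?P (indicator (generated_cone (v(j := p, i := v j))))"
            using ij h orth by (intro IH) (auto simp: psubset_eq u_def)
        qed (use h in auto)
      qed
    next
      case False
      show ?thesis
      proof (cases "{..<m} = {}")
        case True
        \<comment> \<open>With \<open>m\<close> the least index, \<open>i < k < j\<close> already
          forces \<open>m < j\<close>.\<close>
        then have "m \<le> k" for k by (auto simp: lessThan_def not_less)
        then have "?P v"
          using inner.prems unfolding tridiagonal_above_def by (meson order_le_less_trans)
        then show ?thesis by (rule decomposable_indicator)
      next
        case nonempty: False
        define m' where "m' = Max {..<m}"
        have m': "m' < m" "\<And>k. k < m \<Longrightarrow> k \<le> m'"
          using nonempty Max_in[of "{..<m}"] by (auto simp: m'_def)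
        \<comment> \<open>The only index below \<open>m\<close> that may fail orthogonality. The
          transposition below moves it next to \<open>m\<close>, to the predecessor
          \<open>m'\<close>.\<close>
        obtain i0 where i0: "i0 < m" "\<And>i. i < m \<Longrightarrow> i \<noteq> i0 \<Longrightarrow> v i \<bullet> v m = 0"
          using False m'(1) by (cases "?B v = {}") blast+
        define \<pi> where "\<pi> = Transposition.transpose i0 m'"
        have pi: "\<pi> i < m \<longleftrightarrow> i < m" "\<not> i < m \<Longrightarrow> \<pi> i = i" for i
          using i0(1) m'(1) by (auto simp: \<pi>_def Transposition.transpose_def)
        have pi_ne: "\<pi> i \<noteq> i0" if "i \<noteq> m'" for i
          using that by (auto simp: \<pi>_def Transposition.transpose_def)
        have pi_image: "\<pi> ` {..<last_index} = {..<last_index}"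
          unfolding \<pi>_def using last[OF i0(1)] last[OF m'(1)]
          by (intro transpose_image_eq) auto
        have surj: "range \<pi> = UNIV"
          by (simp add: \<pi>_def)
        have "same_flag w (v \<circ> \<pi>)"
          using inner.prems(1) pi_image pi(2)[of last_index] last[of last_index]
          by (simp add: same_flag_def flip: image_image) (metis image_comp less_irrefl)
        moreover have "tridiagonal_above m' (v \<circ> \<pi>)"
          unfolding tridiagonal_above_def comp_def
        proof (intro allI impI)
          fix i k j assume ikj: "i < k" "k < j" "m' < j"
          then have "\<not> j < m" using m'(2) by (meson not_less)
          then have j: "\<pi> j = j" "m \<le> j" by (auto simp: pi)
          show "v (\<pi> i) \<bullet> v (\<pi> j) = 0"
          proof (cases "i < m")
            case True
            show ?thesis
            proof (cases "j = m")
              case True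
              \<comment> \<open>From \<open>i < k < m\<close> it follows that \<open>i < m'\<close>,
                so position \<open>i\<close> does not hold the exceptional vector.\<close>
              then have "i \<noteq> m'" using ikj m'(2)[of k] by auto
              then show ?thesis using True j i0(2) pi_ne pi(1) ikj by auto
            next
              case False
              then show ?thesis
                using True j inner.prems(2) pi(1)[of i] unfolding tridiagonal_above_def by auto
            qed
          next
            case False
            then show ?thesis
              using j inner.prems(2) ikj pi(2)[of i] unfolding tridiagonal_above_def by auto
          qed
        qed
        moreover have "card {..<m'} < card {..<m}"
          using m'(1) by (intro psubset_card_mono) auto
        ultimately have "decomposable ?P (indicator (generated_cone (v \<circ> \<pi>)))"
          by (intro outer.hyps)
        \<comment> \<open>A permutation of the generators leaves their range, hence the cone,
          unchanged.\<close>
        then show ?thesis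
          using surj by (simp flip: image_image add: image_comp[symmetric])
      qed
    qed
  qed
qed

section \<open>Choice of signs and the associated quadratic form\<close>

lemma tridiagonal_signs:
  fixes v :: "'n::{finite,linorder} \<Rightarrow> 'a::real_inner"
  assumes tridiagonal: "\<And>i k j. i < k \<Longrightarrow> k < j \<Longrightarrow> v i \<bullet> v j = 0"
  obtains \<epsilon> :: "'n \<Rightarrow> real" where "\<And>i. \<epsilon> i \<in> {1, -1}"
    "\<And>i j. i \<noteq> j \<Longrightarrow> \<epsilon> i * \<epsilon> j * (v i \<bullet> v j) = - \<bar>v i \<bullet> v j\<bar>"
proof -
  \<comment> \<open>\<open>\<sigma> k\<close> is the sign change required between \<open>k\<close>
    and its successor \<open>Min {k<..}\<close>. At the last index that minimum is unspecified, but
    this value enters no product \<open>\<epsilon> i\<close>.\<close>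
  define \<sigma> :: "'n \<Rightarrow> real" where "\<sigma> k = (if v k \<bullet> v (Min {k<..}) > 0 then -1 else 1)" for k
  define \<epsilon> where "\<epsilon> i = (\<Prod>k<i. \<sigma> k)" for i
  have sign: "\<epsilon> i \<in> {1, -1}" for i
  proof -
    have "(\<Prod>k\<in>A. \<sigma> k) \<in> {1, -1}" for A
      by (induction A rule: infinite_finite_induct) (auto simp: \<sigma>_def)
    then show ?thesis by (simp add: \<epsilon>_def)
  qed
  have ordered: "\<epsilon> i * \<epsilon> j * (v i \<bullet> v j) = - \<bar>v i \<bullet> v j\<bar>" if "i < j" for i j
  proof (cases "\<exists>k. i < k \<and> k < j")
    case True
    then show ?thesis using tridiagonal by auto
  next
    \<comment> \<open>No index lies strictly between, so \<open>j\<close> is the successor of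
      \<open>i\<close> and \<open>\<epsilon> j\<close> has the single extra factor
      \<open>\<sigma> i\<close>.\<close>
    case False
    then have succ: "Min {i<..} = j"
      using that by (intro Min_eqI) (auto simp: not_less, meson not_le)
    have "{..<j} = insert i {..<i}"
      using False that by auto (metis linorder_neqE)
    then have "\<epsilon> j = \<sigma> i * \<epsilon> i"
      by (simp add: \<epsilon>_def)
    moreover have "\<epsilon> i * \<epsilon> i = 1"
      using sign[of i] by auto
    ultimately have "\<epsilon> i * \<epsilon> j = \<sigma> i"
      by (simp add: mult.left_commute)
    then show ?thesis
      by (simp add: \<sigma>_def succ)
  qed
  have "\<epsilon> i * \<epsilon> j * (v i \<bullet> v j) = - \<bar>v i \<bullet> v j\<bar>" if "i \<noteq> j" for i j
    using that ordered[of i j] ordered[of j i]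
    by (cases i j rule: linorder_cases) (auto simp: inner_commute mult.commute)
  with sign show ?thesis by (rule that)
qed

lemma norm_matrix_of_columns:
  fixes u :: "'n::finite \<Rightarrow> real ^ 'm"
  shows "(norm (matrix_of_columns u *v x))\<^sup>2 = (\<Sum>i\<in>UNIV. \<Sum>j\<in>UNIV. x $ i * x $ j * (u i \<bullet> u j))"
proof -
  have "matrix_of_columns u *v x = (\<Sum>i\<in>UNIV. x $ i *\<^sub>R u i)"
    by (simp add: vec_eq_iff matrix_of_columns_def matrix_vector_mult_def mult.commute)
  then show ?thesis
    by (simp add: power2_norm_eq_inner inner_sum_left inner_sum_right sum_distrib_left mult_ac
        inner_commute)
qed

lemma assoc_matrix_quadratic_form:
  fixes u :: "'n::finite \<Rightarrow> real ^ 'n"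
  assumes unit: "\<And>i. norm (u i) = 1" and sign: "\<And>i. \<epsilon> i \<in> {1, -1}"
    and gram: "\<And>i j. i \<noteq> j \<Longrightarrow> \<epsilon> i * \<epsilon> j * (u i \<bullet> u j) = - \<bar>u i \<bullet> u j\<bar>"
  shows "x \<bullet> (assoc_matrix u *v x) = (norm (matrix_of_columns (\<lambda>i. \<epsilon> i *\<^sub>R u i) *v x))\<^sup>2"
proof -
  have entry: "assoc_matrix u $ i $ j = (\<epsilon> i *\<^sub>R u i) \<bullet> (\<epsilon> j *\<^sub>R u j)" for i j
  proof (cases "i = j")
    case True
    have "u j \<bullet> u j = 1" "\<epsilon> j * \<epsilon> j = 1"
      using unit[of j] sign[of j] by (auto simp: norm_eq_1)
    then show ?thesis using True by (simp add: assoc_matrix_def)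
  next
    case False
    then show ?thesis
      using gram[OF False] by (simp add: assoc_matrix_def mult.assoc mult.left_commute)
  qed
  have "x \<bullet> (assoc_matrix u *v x) =
      (\<Sum>i\<in>UNIV. \<Sum>j\<in>UNIV. x $ i * x $ j * assoc_matrix u $ i $ j)"
    by (simp add: inner_vec_def matrix_vector_mult_def sum_distrib_left mult_ac)
  then show ?thesis
    by (simp only: norm_matrix_of_columns entry)
qed

text \<open>The form is a squared norm, hence positive off the kernel of the signed column matrix.
  Signs do not affect independence of the columns, so this kernel is trivial.\<close>

lemma positive_definite_assoc_matrix:
  fixes u :: "'n::finite \<Rightarrow> real ^ 'n"
  assumes ind: "inj u" "independent (range u)" and sign: "\<And>i. \<epsilon> i \<in> {1, -1}"
    and form: "\<And>x. x \<bullet> (assoc_matrix u *v x) =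
      (norm (matrix_of_columns (\<lambda>i. \<epsilon> i *\<^sub>R u i) *v x))\<^sup>2"
  shows "positive_definite (assoc_matrix u)"
proof -
  have "x = 0" if "matrix_of_columns (\<lambda>i. \<epsilon> i *\<^sub>R u i) *v x = 0" for x
  proof -
    have "matrix_of_columns (\<lambda>i. \<epsilon> i *\<^sub>R u i) *v x = (\<Sum>i\<in>UNIV. (x $ i * \<epsilon> i) *\<^sub>R u i)"
      by (simp add: vec_eq_iff matrix_of_columns_def matrix_vector_mult_def mult_ac)
    then have "(\<Sum>i\<in>UNIV. (x $ i * \<epsilon> i) *\<^sub>R u i) = (\<Sum>i\<in>UNIV. 0 *\<^sub>R u i)"
      using that by simp
    then have "x $ i * \<epsilon> i = 0" for i
      by (rule fun_cong[OF independent_sum_eq[OF ind]])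
    moreover have "\<epsilon> i \<noteq> 0" for i
      using sign[of i] by auto
    ultimately show ?thesis
      by (simp add: vec_eq_iff)
  qed
  moreover have "transpose (assoc_matrix u) = assoc_matrix u"
    by (simp add: transpose_def assoc_matrix_def vec_eq_iff inner_commute)
  ultimately show ?thesis
    unfolding positive_definite_def form by (auto simp: zero_less_power2)
qed

section \<open>Normalization of the generators\<close>

lemma generated_cone_scale:
  fixes v :: "'i::finite \<Rightarrow> 'a::real_vector"
  assumes pos: "\<And>i. 0 < c i"
  shows "generated_cone (\<lambda>i. c i *\<^sub>R v i) = generated_cone v"
proof -
  have sub: "generated_cone (\<lambda>i. d i *\<^sub>R u i) \<subseteq> generated_cone u"
    if "\<And>i. 0 < d i" for d and u :: "'i \<Rightarrow> 'a"
    using that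
    by (intro hull_minimal convex_cone_convex_cone_hull image_subsetI convex_cone_hull_mul hull_inc)
      (auto intro: less_imp_le)
  have "generated_cone v = generated_cone (\<lambda>i. (1 / c i) *\<^sub>R c i *\<^sub>R v i)"
    using pos by (simp add: less_imp_neq[symmetric])
  also have "\<dots> \<subseteq> generated_cone (\<lambda>i. c i *\<^sub>R v i)"
    using pos by (intro sub) simp
  finally show ?thesis
    using sub[of c v] pos by blast
qed

lemma span_scale_family:
  fixes v :: "'i \<Rightarrow> 'a::real_vector"
  assumes nz: "\<And>i. c i \<noteq> 0"
  shows "span ((\<lambda>i. c i *\<^sub>R v i) ` A) = span (v ` A)"
proof -
  have sub: "span ((\<lambda>i. d i *\<^sub>R u i) ` A) \<subseteq> span (u ` A)" for d and u :: "'i \<Rightarrow> 'a"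
    by (intro span_minimal subspace_span image_subsetI span_scale span_base) auto
  have "span (v ` A) = span ((\<lambda>i. (1 / c i) *\<^sub>R c i *\<^sub>R v i) ` A)"
    using nz by simp
  also have "\<dots> \<subseteq> span ((\<lambda>i. c i *\<^sub>R v i) ` A)"
    by (rule sub)
  finally show ?thesis
    using sub by blast
qed

text \<open>The moves do not preserve lengths, so unit length is restored only here. Positive
  scaling keeps the cone, all spans and all orthogonality relations.\<close>

lemma normalized_tridiagonal_family:
  fixes v :: "'n \<Rightarrow> real ^ 'n::{finite,linorder}"
  assumes spanning: "span (range v) = UNIV"
    and tridiagonal: "\<forall>i k j. i < k \<longrightarrow> k < j \<longrightarrow> v i \<bullet> v j = 0"
  obtains u \<epsilon> where "u = (\<lambda>i. (1 / norm (v i)) *\<^sub>R v i)"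
    "generated_cone u = generated_cone v" "positive_definite (assoc_matrix u)"
    "\<forall>i. norm (u i) = 1" "\<forall>A. span (u ` A) = span (v ` A)"
    "\<forall>i. \<epsilon> i \<in> {1, -1}"
    "\<forall>x. x \<bullet> (assoc_matrix u *v x) =
      (norm (matrix_of_columns (\<lambda>i. \<epsilon> i *\<^sub>R u i) *v x))\<^sup>2"
proof -
  have nz: "norm (v i) \<noteq> 0" for i
    using spanning_family_independent[OF spanning] dependent_zero[of "range v"]
    by (metis norm_eq_zero rangeI)
  define u where "u = (\<lambda>i. (1 / norm (v i)) *\<^sub>R v i)"
  have norm_u: "norm (u i) = 1" for i
    using nz[of i] by (simp add: u_def)
  have span_u: "span (u ` A) = span (v ` A)" for A
    unfolding u_def using nz by (intro span_scale_family) simp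
  then have ind: "inj u" "independent (range u)"
    using spanning_family_independent[of u] spanning by auto
  have "u i \<bullet> u j = 0" if "i < k" "k < j" for i k j
    using tridiagonal that by (auto simp: u_def)
  then obtain \<epsilon> where \<epsilon>: "\<And>i. \<epsilon> i \<in> {1, -1}"
    "\<And>i j. i \<noteq> j \<Longrightarrow> \<epsilon> i * \<epsilon> j * (u i \<bullet> u j) = - \<bar>u i \<bullet> u j\<bar>"
    using tridiagonal_signs[of u] by metis
  have form: "x \<bullet> (assoc_matrix u *v x) =
      (norm (matrix_of_columns (\<lambda>i. \<epsilon> i *\<^sub>R u i) *v x))\<^sup>2" for x
    using norm_u \<epsilon> by (rule assoc_matrix_quadratic_form)
  have cone: "generated_cone u = generated_cone v"
    unfolding u_def using nz by (intro generated_cone_scale) simp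
  show ?thesis
    by (rule that[of u \<epsilon>, OF u_def cone positive_definite_assoc_matrix[OF ind \<epsilon>(1) form]])
      (intro allI norm_u span_u \<epsilon>(1) form)+
qed

section \<open>Assembly of the decomposition\<close>

theorem theorem3p3:
  fixes w :: "'n \<Rightarrow> real ^ 'n::{finite,linorder}"
  assumes lin_indep: "inj w" "independent (range w)"
    and unit: "\<And>i. norm (w i) = 1"
  shows "\<exists>(N :: nat) (C :: nat \<Rightarrow> (real ^ 'n::{finite,linorder}) set) (s :: nat \<Rightarrow> real).
    (\<forall>m\<in>{1..N}. polyhedral_cone (C m) \<and> s m \<in> {1, -1}) \<and>
    equiv_mod_lower_dim (indicator (generated_cone w)) (\<lambda>x. \<Sum>m=1..N. s m * indicator (C m) x) \<and>
    (\<forall>m\<in>{1..N}.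
       aff_dim (C m) < int CARD('n) \<or>
       (aff_dim (C m) = int CARD('n) \<and>
        (\<exists>v :: 'n \<Rightarrow> real ^ 'n::{finite,linorder}.
           C m = generated_cone v \<and>
           positive_definite (assoc_matrix v) \<and>
           (\<forall>i. norm (v i) = 1) \<and>
           v last_index = w last_index \<and>
           span (v ` {..<last_index}) = span (w ` {..<last_index}) \<and>
           (\<forall>i j. i < j \<and> j < last_index \<longrightarrow> v i \<bullet> v last_index = 0) \<and>
           (\<exists>\<epsilon> :: 'n \<Rightarrow> real. (\<forall>i. \<epsilon> i \<in> {1, -1}) \<and>
              (\<forall>x. x \<bullet> (assoc_matrix v *v x) =
                   (norm (matrix_of_columns (\<lambda>i. \<epsilon> i *\<^sub>R v i) *v x))\<^sup>2)))))"
proof -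
  let ?P = "\<lambda>u. same_flag w u \<and> (\<forall>i k j. i < k \<longrightarrow> k < j \<longrightarrow> u i \<bullet> u j = 0)"
  have "card (range w) = CARD('n)"
    using lin_indep(1) by (rule card_image)
  then have spanning: "span (range w) = UNIV"
    using card_ge_dim_independent[of "range w" UNIV] lin_indep(2) by auto
  \<comment> \<open>The reduction starts from \<open>w\<close> itself at
    \<open>m = last_index\<close>, where nothing is required yet.\<close>
  have "decomposable ?P (indicator (generated_cone w))"
    by (rule tridiagonal_decomposition[OF spanning, of _ last_index])
      (auto simp: same_flag_def tridiagonal_above_def not_less)
  then obtain xs where xs: "\<forall>(s, v)\<in>set xs. s \<in> {1, -1} \<and> ?P v"
    "equiv_mod_lower_dim (indicator (generated_cone w))
      (\<lambda>x. \<Sum>(s, v)\<leftarrow>xs. s * indicator (generated_cone v) x)"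
    unfolding decomposable_def by blast
  \<comment> \<open>The sum runs over \<open>1..N\<close>, whereas list positions start at
    0.\<close>
  define s where "s m = fst (xs ! (m - 1))" for m
  define V where "V m = snd (xs ! (m - 1))" for m
  have sV: "s m \<in> {1, -1}" "?P (V m)" if "m \<in> {1..length xs}" for m
  proof -
    have "(s m, V m) \<in> set xs"
      using that by (auto simp: s_def V_def intro!: nth_mem)
    from bspec[OF xs(1) this] show "s m \<in> {1, -1}" "?P (V m)"
      unfolding prod.case by (rule conjunct1, rule conjunct2)
  qed
  have "(\<Sum>(s, v)\<leftarrow>xs. s * indicator (generated_cone v) x) =
      (\<Sum>m=1..length xs. s m * indicator (generated_cone (V m)) x)" for x
    by (simp add: sum_list_sum_nth sum.atLeast1_atMost_eq atLeast0LessThan s_def V_def case_prod_beta)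
  then have equiv: "equiv_mod_lower_dim (indicator (generated_cone w))
      (\<lambda>x. \<Sum>m=1..length xs. s m * indicator (generated_cone (V m)) x)"
    using xs(2) by simp
  \<comment> \<open>Every listed cone is of type (II); cones of lower dimension occur only inside
    the equivalence.\<close>
  have good: "aff_dim (generated_cone (V m)) = int CARD('n) \<and>
        (\<exists>v :: 'n \<Rightarrow> real ^ 'n::{finite,linorder}.
           generated_cone (V m) = generated_cone v \<and>
           positive_definite (assoc_matrix v) \<and>
           (\<forall>i. norm (v i) = 1) \<and>
           v last_index = w last_index \<and>
           span (v ` {..<last_index}) = span (w ` {..<last_index}) \<and>
           (\<forall>i j. i < j \<and> j < last_index \<longrightarrow> v i \<bullet> v last_index = 0) \<and>
           (\<exists>\<epsilon> :: 'n \<Rightarrow> real. (\<forall>i. \<epsilon> i \<in> {1, -1}) \<and>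
              (\<forall>x. x \<bullet> (assoc_matrix v *v x) =
                   (norm (matrix_of_columns (\<lambda>i. \<epsilon> i *\<^sub>R v i) *v x))\<^sup>2)))"
    if m: "m \<in> {1..length xs}" for m
  proof -
    have flag: "same_flag w (V m)" and tri: "\<forall>i k j. i < k \<longrightarrow> k < j \<longrightarrow> V m i \<bullet> V m j = 0"
      using sV(2)[OF m] by auto
    have span_V: "span (range (V m)) = UNIV"
      using same_flag_span[OF flag] spanning by simp
    then have "dim (range (V m)) = CARD('n)"
      by (metis DIM_cart DIM_real dim_UNIV dim_span mult.right_neutral)
    then have dim: "aff_dim (generated_cone (V m)) = int CARD('n)"
      by (simp add: aff_dim_generated_cone)
    obtain v \<epsilon> where v: "v = (\<lambda>i. (1 / norm (V m i)) *\<^sub>R V m i)"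
      and props: "generated_cone v = generated_cone (V m)" "positive_definite (assoc_matrix v)"
        "\<forall>i. norm (v i) = 1" "\<forall>A. span (v ` A) = span (V m ` A)"
        "\<forall>i. \<epsilon> i \<in> {1, -1}"
        "\<forall>x. x \<bullet> (assoc_matrix v *v x) =
          (norm (matrix_of_columns (\<lambda>i. \<epsilon> i *\<^sub>R v i) *v x))\<^sup>2"
      by (rule normalized_tridiagonal_family[OF span_V tri]) (rule that; assumption)
    \<comment> \<open>Normalization fixes the last vector, because \<open>w last_index\<close>
      already has norm 1.\<close>
    have "v last_index = w last_index"
      using flag unit by (simp add: v same_flag_def)
    moreover have "span (v ` {..<last_index}) = span (w ` {..<last_index})"
      using flag by (simp add: props(4) same_flag_def)
    \<comment> \<open>Property (d) is tridiagonality in the last column, with \<open>j\<close> as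
      the index in between.\<close>
    moreover have "v i \<bullet> v last_index = 0" if "i < j \<and> j < last_index" for i j
      using tri[rule_format, of i j last_index] that
      by (simp add: v)
    ultimately show ?thesis
      using props(5)
      by (intro exI[of _ v] exI[of _ \<epsilon>] conjI dim props(1)[symmetric] props(2,3,6) allI impI) blast+
  qed
  show ?thesis
    by (rule exI[of _ "length xs"], rule exI[of _ "\<lambda>m. generated_cone (V m)"], rule exI[of _ s],
        intro conjI ballI)
      (rule polyhedral_generated_cone equiv | erule sV(1) | rule disjI2, erule good)+
qed

end
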